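(* Let $a,b,c$ be positive integers. For every integer $n\ge 0$ the following two identities hold in $\mathfrak{H}^1$ (all sums run over non-negative integers with the indicated total): $$(\alpha_n)\quad d\big(z_c^2 \,\widetilde{\sqcup\!\sqcup}\, (z_a z_b)^n\big) = 2 \sum_{j+k=n} d\big(z_c \,\widetilde{\sqcup\!\sqcup}\, (z_a z_b)^j\big) * z_{(a+b)k+c} + \sum_{j+k=n} \big(z_c^2 \,\widetilde{\sqcup\!\sqcup}\, (z_a z_b)^j\big) * d(z_{a+b}^k) - 4 \sum_{i+j+k=n} d\big((z_a z_b)^i\big) * \big(z_{(a+b)j+c}\, z_{(a+b)k+c}\big) - \sum_{j+k=n} d\big((z_a z_b)^j\big) * z_{(a+b)k+2c},$$ $$(\beta_n)\quad d\big(z_c^2 \,\widetilde{\sqcup\!\sqcup}\, z_b(z_a z_b)^n\big) = 2 \sum_{j+k=n} d\big(z_c \,\widetilde{\sqcup\!\sqcup}\, z_b(z_a z_b)^j\big) * z_{(a+b)k+c} + \sum_{j+k=n} \big(z_c^2 \,\widetilde{\sqcup\!\sqcup}\, z_b(z_a z_b)^j\big) * d(z_{a+b}^k) - 4 \sum_{i+j+k=n} d\big(z_b(z_a z_b)^i\big) * \big(z_{(a+b)j+c}\, z_{(a+b)k+c}\big) - \sum_{j+k=n} d\big(z_b(z_a z_b)^j\big) * z_{(a+b)k+2c}.$$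
   Context: Let $\mathfrak{H}=\mathbb{Q}\langle x,y\rangle$ be the noncommutative polynomial algebra in two indeterminates and $\mathfrak{H}^1=\mathbb{Q}+\mathfrak{H}y$. For $l\ge1$ put $z_l=x^{l-1}y$; then $\mathfrak{H}^1$ is the free noncommutative polynomial algebra over $\mathbb{Q}$ on $z_1,z_2,\dots$. Juxtaposition of words denotes concatenation, and powers such as $z_c^2$, $(z_az_b)^n$, $z_{a+b}^k$ are concatenation powers (the $0$-th power is the empty word $1$). Let $\gamma$ be the algebra automorphism of $\mathfrak{H}$ with $\gamma(x)=x$, $\gamma(y)=x+y$, and let $d:\mathfrak{H}^1\to\mathfrak{H}^1$ be the $\mathbb{Q}$-linear map with $d(wy)=\gamma(w)y$ for every word $w\in\mathfrak{H}$ and $d(1)=1$. The harmonic product $*$ is the $\mathbb{Q}$-bilinear map on $\mathfrak{H}^1$ with $1*w=w*1=w$ and $z_{k_1}w * z_{k_2}w' = z_{k_1}(w * z_{k_2}w') + z_{k_2}(z_{k_1}w * w') + z_{k_1+k_2}(w*w')$ for words $w,w'\in\mathfrak{H}^1$ and positive integers $k_1,k_2$. The product $\widetilde{\sqcup\!\sqcup}$ is the $\mathbb{Q}$-bilinear map on $\mathfrak{H}^1$ with $1\,\widetilde{\sqcup\!\sqcup}\, w=w\,\widetilde{\sqcup\!\sqcup}\,1=w$ and $z_{k_1}w \,\widetilde{\sqcup\!\sqcup}\, z_{k_2}w' = z_{k_1}(w \,\widetilde{\sqcup\!\sqcup}\, z_{k_2}w') + z_{k_2}(z_{k_1}w \,\widetilde{\sqcup\!\sqcup}\,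 w')$ (i.e. the shuffle product with respect to the letters $z_k$). Both products are commutative and associative. *)

theory Defs
  imports Complex_Main "HOL-Library.Poly_Mapping"
begin

section \<open>The algebra of noncommutative polynomials in \<open>x\<close> and \<open>y\<close>\<close>

datatype letter = Letter_x | Letter_y

datatype word = Word (letters: "letter list")

text \<open>
  Words form a monoid under concatenation, written additively because the convolution product of
  \<^theory>\<open>HOL-Library.Poly_Mapping\<close> expects an additive monoid of exponents. The resulting
  multiplication on finitely supported functions from words to the rationals is concatenation
  of words, extended bilinearly, and \<open>^\<close> is the concatenation power.
\<close>

instantiation word :: monoid_add
begin

definition zero_word :: word where
  "0 = Word []"

definition plus_word :: "word \<Rightarrow> word \<Rightarrow> word" where
  "u + v = Word (letters u @ letters v)"

instance
  by standard (simp_all add: zero_word_def plus_word_def)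

end

type_synonym ncpoly = "word \<Rightarrow>\<^sub>0 rat"

definition mon :: "word \<Rightarrow> ncpoly" where
  "mon w = Poly_Mapping.single w 1"

definition scal :: "rat \<Rightarrow> ncpoly \<Rightarrow> ncpoly" where
  "scal c p = Poly_Mapping.single 0 c * p"

definition linext :: "(word \<Rightarrow> ncpoly) \<Rightarrow> ncpoly \<Rightarrow> ncpoly" where
  "linext f p = (\<Sum>w\<in>Poly_Mapping.keys p. scal (Poly_Mapping.lookup p w) (f w))"

definition px :: ncpoly where
  "px = mon (Word [Letter_x])"

definition py :: ncpoly where
  "py = mon (Word [Letter_y])"

definition H1 :: "ncpoly set" where
  "H1 = {scal c 1 + p * py | c p. True}"

text \<open>Only indices \<open>l > 0\<close> are meaningful; by truncated subtraction \<open>z 0 = z 1\<close>.\<close>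

definition z :: "nat \<Rightarrow> ncpoly" where
  "z l = px ^ (l - 1) * py"

section \<open>The maps \<open>\<gamma>\<close> and \<open>d\<close>\<close>

primrec gamma_letter :: "letter \<Rightarrow> ncpoly" where
  "gamma_letter Letter_x = px"
| "gamma_letter Letter_y = px + py"

definition gamma_map :: "ncpoly \<Rightarrow> ncpoly" where
  "gamma_map = linext (\<lambda>w. prod_list (map gamma_letter (letters w)))"

text \<open>Words ending in \<open>x\<close> do not lie in \<^const>\<open>H1\<close>; they are sent to \<open>0\<close>.\<close>

definition d_word :: "word \<Rightarrow> ncpoly" where
  "d_word w =
     (if letters w = [] then 1
      else if last (letters w) = Letter_y
        then gamma_map (mon (Word (butlast (letters w)))) * py
      else 0)"

definition d :: "ncpoly \<Rightarrow> ncpoly" where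
  "d = linext d_word"

section \<open>The harmonic product and the shuffle product in the letters \<open>z\<^sub>k\<close>\<close>

text \<open>
  A word in \<^const>\<open>H1\<close> is a product of letters \<open>z\<^sub>k\<close> with \<open>k > 0\<close> in a unique way;
  \<open>z_indices\<close> reads off the indices, where \<open>z_indices_from m w\<close> is the index
  list of \<open>x\<close> to the power \<open>m\<close> times \<open>w\<close>.
\<close>

fun z_indices_from :: "nat \<Rightarrow> letter list \<Rightarrow> nat list" where
  "z_indices_from m [] = []"
| "z_indices_from m (Letter_x # w) = z_indices_from (Suc m) w"
| "z_indices_from m (Letter_y # w) = Suc m # z_indices_from 0 w"

definition z_indices :: "word \<Rightarrow> nat list" where
  "z_indices w = z_indices_from 0 (letters w)"

definition z_prod :: "nat list \<Rightarrow> ncpoly" where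
  "z_prod ks = prod_list (map z ks)"

fun harmonic_indices :: "nat list \<Rightarrow> nat list \<Rightarrow> ncpoly" where
  "harmonic_indices [] ls = z_prod ls"
| "harmonic_indices ks [] = z_prod ks"
| "harmonic_indices (k # ks) (l # ls) =
     z k * harmonic_indices ks (l # ls) + z l * harmonic_indices (k # ks) ls
       + z (k + l) * harmonic_indices ks ls"

fun shuffle_indices :: "nat list \<Rightarrow> nat list \<Rightarrow> ncpoly" where
  "shuffle_indices [] ls = z_prod ls"
| "shuffle_indices ks [] = z_prod ks"
| "shuffle_indices (k # ks) (l # ls) =
     z k * shuffle_indices ks (l # ls) + z l * shuffle_indices (k # ks) ls"

text \<open>Both products are meant for arguments in \<^const>\<open>H1\<close> only; no use is made of the
  values elsewhere.\<close>

definition harmonic :: "ncpoly \<Rightarrow> ncpoly \<Rightarrow> ncpoly" (infixl "\<star>" 70) where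
  "p \<star> q = linext (\<lambda>u. linext (\<lambda>v. harmonic_indices (z_indices u) (z_indices v)) q) p"

definition zshuffle :: "ncpoly \<Rightarrow> ncpoly \<Rightarrow> ncpoly" (infixl "\<diamondop>" 70) where
  "p \<diamondop> q = linext (\<lambda>u. linext (\<lambda>v. shuffle_indices (z_indices u) (z_indices v)) q) p"

section \<open>Characterizing properties\<close>

lemma mon_0: "mon 0 = 1"
  by (simp add: mon_def)

lemma mon_mult: "mon u * mon v = mon (u + v)"
  by (simp add: mon_def mult_single)

lemma scal_add: "scal (a + b) p = scal a p + scal b p"
  by (simp add: scal_def single_add distrib_right)

lemma scal_add_right: "scal a (p + q) = scal a p + scal a q"
  by (simp add: scal_def distrib_left)

lemma scal_scal: "scal a (scal b p) = scal (a * b) p"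
  by (simp add: scal_def mult_single flip: mult.assoc)

lemma scal_0 [simp]: "scal 0 p = 0"
  by (simp add: scal_def)

lemma scal_zero_right [simp]: "scal a 0 = 0"
  by (simp add: scal_def)

lemma scal_1 [simp]: "scal 1 p = p"
  by (simp add: scal_def)

lemma scal_single: "scal c (Poly_Mapping.single w a) = Poly_Mapping.single w (c * a)"
  by (simp add: scal_def mult_single)

lemma ncpoly_induct [case_names single sum]:
  fixes p :: ncpoly
  assumes single: "\<And>w c. P (Poly_Mapping.single w c)"
    and sum: "\<And>p q. P p \<Longrightarrow> P q \<Longrightarrow> P (p + q)"
  shows "P p"
proof -
  have "P (\<Sum>w\<in>A. Poly_Mapping.single w (Poly_Mapping.lookup p w))" if "finite A" for A
    using that
  proof (induction A rule: finite_induct)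
    case empty
    then show ?case using single[of 0 0] by simp
  qed (simp add: assms)
  moreover have "(\<Sum>w\<in>Poly_Mapping.keys p. Poly_Mapping.single w (Poly_Mapping.lookup p w)) = p"
    by (rule poly_mapping_eqI) (simp add: lookup_sum lookup_single when_def in_keys_iff)
  ultimately show ?thesis by (metis finite_keys)
qed

lemma single_0_commute: "Poly_Mapping.single 0 c * p = p * (Poly_Mapping.single 0 c :: ncpoly)"
proof (induction p rule: ncpoly_induct)
  case (single k v)
  then show ?case by (simp add: mult_single mult.commute)
next
  case (sum p q)
  then show ?case by (simp add: distrib_left distrib_right)
qed

lemma scal_mult_left: "scal c p * q = scal c (p * q)"
  by (simp add: scal_def mult.assoc)

lemma scal_mult_right: "p * scal c q = scal c (p * q)"
  by (metis scal_def mult.assoc single_0_commute)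

lemma linext_superset:
  assumes "finite A" "Poly_Mapping.keys p \<subseteq> A"
  shows "linext f p = (\<Sum>w\<in>A. scal (Poly_Mapping.lookup p w) (f w))"
  unfolding linext_def using assms
  by (intro sum.mono_neutral_left) (auto simp: in_keys_iff)

lemma linext_add: "linext f (p + q) = linext f p + linext f q"
proof -
  let ?A = "Poly_Mapping.keys p \<union> Poly_Mapping.keys q"
  have "linext f (p + q) = (\<Sum>w\<in>?A. scal (Poly_Mapping.lookup (p + q) w) (f w))"
    by (intro linext_superset) (use keys_add[of p q] in auto)
  also have "\<dots> = (\<Sum>w\<in>?A. scal (Poly_Mapping.lookup p w) (f w))
      + (\<Sum>w\<in>?A. scal (Poly_Mapping.lookup q w) (f w))"
    by (simp add: lookup_add scal_add sum.distrib)
  also have "\<dots> = linext f p + linext f q"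
    by (simp add: linext_superset[of ?A])
  finally show ?thesis .
qed

lemma linext_single: "linext f (Poly_Mapping.single w c) = scal c (f w)"
  by (simp add: linext_superset[of "{w}"])

lemma linext_mon [simp]: "linext f (mon w) = f w"
  by (simp add: mon_def linext_single)

lemma linext_scal: "linext f (scal c p) = scal c (linext f p)"
proof (induction p rule: ncpoly_induct)
  case (single k v)
  then show ?case
    by (simp add: linext_single scal_scal scal_single)
next
  case (sum p q)
  then show ?case by (simp add: linext_add scal_add_right)
qed

lemma linext_fun_add: "linext (\<lambda>w. f w + g w) p = linext f p + linext g p"
  by (simp add: linext_def scal_add_right sum.distrib)

lemma linext_fun_scal: "linext (\<lambda>w. scal c (f w)) p = scal c (linext f p)"
proof (induction p rule: ncpoly_induct)
  case (single k v)
  then show ?case by (simp add: linext_single scal_scal mult.commute)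
next
  case (sum p q)
  then show ?case by (simp add: linext_add scal_add_right)
qed

lemma gamma_map_add: "gamma_map (p + q) = gamma_map p + gamma_map q"
  by (simp add: gamma_map_def linext_add)

lemma gamma_map_scal: "gamma_map (scal c p) = scal c (gamma_map p)"
  by (simp add: gamma_map_def linext_scal)

lemma gamma_map_mult: "gamma_map (p * q) = gamma_map p * gamma_map q"
proof (induction p rule: ncpoly_induct)
  case (single u a)
  show ?case
  proof (induction q rule: ncpoly_induct)
    case (single v b)
    then show ?case
      by (simp add: gamma_map_def mult_single linext_single plus_word_def scal_mult_left
          scal_mult_right scal_scal mult.commute[of a b])
  next
    case (sum p q)
    then show ?case by (simp add: gamma_map_add distrib_left)
  qed
next
  case (sum p q)
  then show ?case by (simp add: gamma_map_add distrib_right)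
qed

lemma gamma_map_1: "gamma_map 1 = 1"
  by (simp add: gamma_map_def zero_word_def flip: mon_0)

lemma gamma_map_px: "gamma_map px = px"
  by (simp add: gamma_map_def px_def)

lemma gamma_map_py: "gamma_map py = px + py"
  by (simp add: gamma_map_def py_def)

lemma d_add: "d (p + q) = d p + d q"
  by (simp add: d_def linext_add)

lemma d_scal: "d (scal c p) = scal c (d p)"
  by (simp add: d_def linext_scal)

lemma d_1: "d 1 = 1"
  by (simp add: d_def d_word_def zero_word_def flip: mon_0)

lemma d_mult_py: "d (p * py) = gamma_map p * py"
proof (induction p rule: ncpoly_induct)
  case (single w c)
  then show ?case
    by (simp add: d_def py_def mon_def mult_single linext_single plus_word_def d_word_def
        gamma_map_def scal_mult_left)
next
  case (sum p q)
  then show ?case by (simp add: d_add gamma_map_add distrib_right)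
qed

definition z_word :: "nat list \<Rightarrow> word" where
  "z_word ks = Word (concat (map (\<lambda>k. replicate (k - 1) Letter_x @ [Letter_y]) ks))"

lemma px_power: "px ^ m = mon (Word (replicate m Letter_x))"
  by (induction m) (simp_all add: px_def mon_mult plus_word_def flip: mon_0 zero_word_def)

lemma z_eq: "z k = mon (Word (replicate (k - 1) Letter_x @ [Letter_y]))"
  by (simp add: z_def px_power py_def mon_mult plus_word_def)

lemma z_prod_Nil [simp]: "z_prod [] = 1"
  and z_prod_Cons [simp]: "z_prod (k # ks) = z k * z_prod ks"
  by (simp_all add: z_prod_def)

lemma z_prod_eq: "z_prod ks = mon (z_word ks)"
  by (induction ks)
    (simp_all add: z_word_def z_eq mon_mult plus_word_def mon_0 flip: zero_word_def)

lemma z_indices_from_append: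
  "z_indices_from m (replicate k Letter_x @ w) = z_indices_from (m + k) w"
  by (induction k arbitrary: m) simp_all

lemma z_indices_z_word: "0 \<notin> set ks \<Longrightarrow> z_indices (z_word ks) = ks"
  by (induction ks) (auto simp: z_indices_def z_word_def z_indices_from_append)

lemma z_word_z_indices_from:
  "w = [] \<and> m = 0 \<or> w \<noteq> [] \<and> last w = Letter_y \<Longrightarrow>
   letters (z_word (z_indices_from m w)) = replicate m Letter_x @ w \<and> 0 \<notin> set (z_indices_from m w)"
proof (induction m w rule: z_indices_from.induct)
  case (2 m w)
  then show ?case
    by (cases "w = []") (auto simp flip: replicate_app_Cons_same)
next
  case (3 m w)
  then show ?case
    by (cases "w = []") (auto simp: z_word_def)
qed (auto simp: z_word_def)

lemma z_word_z_indices: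
  assumes "letters w = [] \<or> last (letters w) = Letter_y"
  shows "z_word (z_indices w) = w" "0 \<notin> set (z_indices w)"
proof -
  have "letters (z_word (z_indices w)) = letters w \<and> 0 \<notin> set (z_indices w)"
    using z_word_z_indices_from[of "letters w" 0] assms by (auto simp: z_indices_def)
  then show "z_word (z_indices w) = w" "0 \<notin> set (z_indices w)"
    by (simp_all add: word.expand[of "z_word (z_indices w)" w])
qed

text \<open>\<^const>\<open>H1\<close> has the products of the \<open>z\<^sub>k\<close>, \<open>k > 0\<close>, as a basis (distinct index lists
  give distinct words by \<open>z_indices_z_word\<close>), and it is closed under all operations used.\<close>

lemma H1_iff:
  "p \<in> H1 \<longleftrightarrow> (\<forall>w\<in>Poly_Mapping.keys p. letters w = [] \<or> last (letters w) = Letter_y)"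
proof
  assume "p \<in> H1"
  then obtain c q where p: "p = scal c 1 + q * py" by (auto simp: H1_def)
  show "\<forall>w\<in>Poly_Mapping.keys p. letters w = [] \<or> last (letters w) = Letter_y"
  proof
    fix w assume "w \<in> Poly_Mapping.keys p"
    then have "w \<in> Poly_Mapping.keys (scal c 1) \<or> w \<in> Poly_Mapping.keys (q * py)"
      using keys_add[of "scal c 1" "q * py"] unfolding p by (meson UnE subsetD)
    then show "letters w = [] \<or> last (letters w) = Letter_y"
    proof
      assume "w \<in> Poly_Mapping.keys (scal c 1)"
      then show ?thesis by (auto simp: scal_def zero_word_def split: if_splits)
    next
      assume "w \<in> Poly_Mapping.keys (q * py)"
      then obtain u v where "w = u + v" "v \<in> Poly_Mapping.keys py"
        using keys_mult[of q py] by fast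
      then show ?thesis by (auto simp: py_def mon_def plus_word_def)
    qed
  qed
next
  let ?S = "\<lambda>w. letters w = [] \<or> last (letters w) = Letter_y"
  assume *: "\<forall>w\<in>Poly_Mapping.keys p. ?S w"
  have "0 = scal 0 1 + 0 * py" by simp
  then have zero: "0 \<in> H1" unfolding H1_def by blast
  have add: "p + q \<in> H1" if pq: "p \<in> H1" "q \<in> H1" for p q
  proof -
    obtain a p' b q' where "p = scal a 1 + p' * py" "q = scal b 1 + q' * py"
      using pq unfolding H1_def by blast
    then have "p + q = scal (a + b) 1 + (p' + q') * py"
      by (simp add: scal_add distrib_right add.assoc add.left_commute)
    then show ?thesis unfolding H1_def by blast
  qed
  have single: "Poly_Mapping.single w c \<in> H1" if "?S w" for w c
  proof (cases "letters w = []")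
    case True
    then have "w = 0" by (metis word.collapse zero_word_def)
    then have "Poly_Mapping.single w c = scal c 1 + 0 * py"
      by (simp add: scal_def)
    then show ?thesis unfolding H1_def by blast
  next
    case False
    with that have "Word (butlast (letters w)) + Word [Letter_y] = w"
      using append_butlast_last_id[of "letters w"] by (simp add: plus_word_def)
    then have "Poly_Mapping.single w c =
        scal 0 1 + Poly_Mapping.single (Word (butlast (letters w))) c * py"
      by (simp add: py_def mon_def mult_single)
    then show ?thesis unfolding H1_def by blast
  qed
  have "(\<Sum>w\<in>A. Poly_Mapping.single w (Poly_Mapping.lookup p w)) \<in> H1"
    if "finite A" "A \<subseteq> Poly_Mapping.keys p" for A
    using that by (induction A rule: finite_induct) (use * zero add single in auto)
  moreover have "(\<Sum>w\<in>Poly_Mapping.keys p. Poly_Mapping.single w (Poly_Mapping.lookup p w)) = p"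
    by (rule poly_mapping_eqI) (simp add: lookup_sum lookup_single when_def in_keys_iff)
  ultimately show "p \<in> H1" by (metis finite_keys order_refl)
qed

lemma H1_add: "p \<in> H1 \<Longrightarrow> q \<in> H1 \<Longrightarrow> p + q \<in> H1"
  using keys_add[of p q] by (auto simp: H1_iff)

lemma H1_mult:
  assumes "p \<in> H1" "q \<in> H1"
  shows "p * q \<in> H1"
  unfolding H1_iff
proof
  fix w assume "w \<in> Poly_Mapping.keys (p * q)"
  then obtain u v where "w = u + v" "u \<in> Poly_Mapping.keys p" "v \<in> Poly_Mapping.keys q"
    using keys_mult[of p q] by blast
  with assms show "letters w = [] \<or> last (letters w) = Letter_y"
    by (auto simp: H1_iff plus_word_def last_append)
qed

lemma H1_z: "z k \<in> H1"
  by (simp add: H1_iff z_eq mon_def)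

lemma H1_z_prod: "z_prod ks \<in> H1"
proof (induction ks)
  case Nil
  show ?case by (simp add: H1_iff zero_word_def)
qed (simp add: H1_mult H1_z)

lemma H1_scal: "p \<in> H1 \<Longrightarrow> scal c p \<in> H1"
proof -
  have "scal c 1 \<in> H1"
    by (simp add: H1_iff scal_def zero_word_def)
  then show "scal c p \<in> H1" if "p \<in> H1"
    using H1_mult[of "scal c 1" p] that by (simp add: scal_mult_left)
qed

lemma H1_linext:
  assumes "\<And>w. f w \<in> H1"
  shows "linext f p \<in> H1"
proof (induction p rule: ncpoly_induct)
  case (single w c)
  then show ?case by (simp add: linext_single H1_scal assms)
next
  case (sum p q)
  then show ?case by (simp add: linext_add H1_add)
qed

lemma H1_d: "d p \<in> H1"
proof -
  have "q * py \<in> H1" for q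
    unfolding H1_def using scal_0[of 1] by (metis (mono_tags, lifting) add_0 mem_Collect_eq)
  moreover have "1 \<in> H1" "0 \<in> H1"
    by (auto simp: H1_iff zero_word_def)
  ultimately show ?thesis
    unfolding d_def by (intro H1_linext) (auto simp: d_word_def)
qed

lemma H1_harmonic: "p \<star> q \<in> H1"
proof -
  have "harmonic_indices ks ls \<in> H1" for ks ls
    by (induction ks ls rule: harmonic_indices.induct)
      (auto simp del: z_prod_Cons intro!: H1_add H1_mult H1_z H1_z_prod)
  then show ?thesis unfolding harmonic_def by (intro H1_linext)
qed

lemma H1_zshuffle: "p \<diamondop> q \<in> H1"
proof -
  have "shuffle_indices ks ls \<in> H1" for ks ls
    by (induction ks ls rule: shuffle_indices.induct)
      (auto simp del: z_prod_Cons intro!: H1_add H1_mult H1_z H1_z_prod)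
  then show ?thesis unfolding zshuffle_def by (intro H1_linext)
qed

lemma one_harmonic: "0 \<notin> set ks \<Longrightarrow> 1 \<star> z_prod ks = z_prod ks"
  and harmonic_one: "0 \<notin> set ks \<Longrightarrow> z_prod ks \<star> 1 = z_prod ks"
  and harmonic_Cons:
    "0 \<notin> set (k # ks) \<Longrightarrow> 0 \<notin> set (l # ls) \<Longrightarrow>
      (z k * z_prod ks) \<star> (z l * z_prod ls) =
        z k * (z_prod ks \<star> (z l * z_prod ls)) + z l * ((z k * z_prod ks) \<star> z_prod ls)
          + z (k + l) * (z_prod ks \<star> z_prod ls)"
proof -
  have *: "z_prod ks \<star> z_prod ls = harmonic_indices ks ls"
    if "0 \<notin> set ks" "0 \<notin> set ls" for ks ls
    using that by (simp add: z_prod_eq harmonic_def z_indices_z_word)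
  show "1 \<star> z_prod ks = z_prod ks" if "0 \<notin> set ks"
    using *[of "[]" ks] that by simp
  show "z_prod ks \<star> 1 = z_prod ks" if "0 \<notin> set ks"
    using *[of ks "[]"] that by (cases ks) simp_all
  show "(z k * z_prod ks) \<star> (z l * z_prod ls) =
        z k * (z_prod ks \<star> (z l * z_prod ls)) + z l * ((z k * z_prod ks) \<star> z_prod ls)
          + z (k + l) * (z_prod ks \<star> z_prod ls)"
    if "0 \<notin> set (k # ks)" "0 \<notin> set (l # ls)"
    using that *[of "k # ks" "l # ls"] *[of ks "l # ls"] *[of "k # ks" ls] *[of ks ls] by simp
qed

lemma one_zshuffle: "0 \<notin> set ks \<Longrightarrow> 1 \<diamondop> z_prod ks = z_prod ks"
  and zshuffle_one: "0 \<notin> set ks \<Longrightarrow> z_prod ks \<diamondop> 1 = z_prod ks"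
  and zshuffle_Cons:
    "0 \<notin> set (k # ks) \<Longrightarrow> 0 \<notin> set (l # ls) \<Longrightarrow>
      (z k * z_prod ks) \<diamondop> (z l * z_prod ls) =
        z k * (z_prod ks \<diamondop> (z l * z_prod ls)) + z l * ((z k * z_prod ks) \<diamondop> z_prod ls)"
proof -
  have *: "z_prod ks \<diamondop> z_prod ls = shuffle_indices ks ls"
    if "0 \<notin> set ks" "0 \<notin> set ls" for ks ls
    using that by (simp add: z_prod_eq zshuffle_def z_indices_z_word)
  show "1 \<diamondop> z_prod ks = z_prod ks" if "0 \<notin> set ks"
    using *[of "[]" ks] that by simp
  show "z_prod ks \<diamondop> 1 = z_prod ks" if "0 \<notin> set ks"
    using *[of ks "[]"] that by (cases ks) simp_all
  show "(z k * z_prod ks) \<diamondop> (z l * z_prod ls) =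
        z k * (z_prod ks \<diamondop> (z l * z_prod ls)) + z l * ((z k * z_prod ks) \<diamondop> z_prod ls)"
    if "0 \<notin> set (k # ks)" "0 \<notin> set (l # ls)"
    using that *[of "k # ks" "l # ls"] *[of ks "l # ls"] *[of "k # ks" ls] by simp
qed

lemma harmonic_add_left: "(p + q) \<star> r = p \<star> r + q \<star> r"
  and harmonic_add_right: "r \<star> (p + q) = r \<star> p + r \<star> q"
  and harmonic_scal_left: "scal c p \<star> r = scal c (p \<star> r)"
  and harmonic_scal_right: "r \<star> scal c p = scal c (r \<star> p)"
  by (simp_all add: harmonic_def linext_add linext_scal linext_fun_add linext_fun_scal)

lemma zshuffle_add_left: "(p + q) \<diamondop> r = p \<diamondop> r + q \<diamondop> r"
  and zshuffle_add_right: "r \<diamondop> (p + q) = r \<diamondop> p + r \<diamondop> q"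
  and zshuffle_scal_left: "scal c p \<diamondop> r = scal c (p \<diamondop> r)"
  and zshuffle_scal_right: "r \<diamondop> scal c p = scal c (r \<diamondop> p)"
  by (simp_all add: zshuffle_def linext_add linext_scal linext_fun_add linext_fun_scal)

end

theory Submission
  imports
    Defs
    "HOL-Computational_Algebra.Polynomial"
    "HOL-Computational_Algebra.Formal_Power_Series"
begin

text \<open>
  A word \<open>z\<^sub>k\<^sub>1 \<dots> z\<^sub>k\<^sub>r\<close> is evaluated at finitely many numbers as a monomial quasi-symmetric function,
  the sum of \<open>t\<^sub>i\<^sub>1\<^sup>k\<^sup>1 \<dots> t\<^sub>i\<^sub>r\<^sup>k\<^sup>r\<close> over strictly increasing \<open>i\<close>. This turns the harmonic product
  into multiplication, is faithful on \<^const>\<open>H1\<close>, and composing it with \<^const>\<open>d\<close> replaces strictly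
  by weakly increasing \<open>i\<close>. Let \<open>\<epsilon>\<close> count the letters \<open>z\<^sub>c\<close> and \<open>u\<close> the letters \<open>z\<^sub>a\<close>, \<open>z\<^sub>b\<close>. A single
  variable \<open>t\<close> contributes the factor \<open>1 + \<epsilon> s + P\<close> to the generating function \<open>S(\<epsilon>)\<close> of the
  evaluated words and \<open>(1 - \<epsilon> s - P)\<^sup>-\<^sup>1\<close> to the generating function \<open>D(\<epsilon>)\<close> of the evaluated images under
  \<^const>\<open>d\<close>, where \<open>s = t\<^sup>c\<close> and \<open>P\<close> is a 2 by 2 matrix with \<open>P\<^sup>2 = q = u\<^sup>2 t\<^sup>a\<^sup>+\<^sup>b\<close>. As
  \<open>(1 - \<epsilon> s - P) (1 - \<epsilon> s + P) = (1 - \<epsilon> s)\<^sup>2 - q = (1 - q) (1 - 2 \<epsilon> g + \<epsilon>\<^sup>2 g s)\<close> with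
  \<open>g = s / (1 - q)\<close>, one gets \<open>D(\<epsilon>) \<Prod>(1 - 2 \<epsilon> g + \<epsilon>\<^sup>2 g s) = S(-\<epsilon>) \<Prod>(1 - q)\<^sup>-\<^sup>1\<close>, the products running over
  the variables. The theorem is the coefficient of \<open>\<epsilon>\<^sup>2\<close>.
\<close>

section \<open>Evaluation of words at finite sequences of numbers\<close>

fun monomial_qsym :: "rat list \<Rightarrow> nat list \<Rightarrow> rat" where
  "monomial_qsym ts [] = 1"
| "monomial_qsym [] (k # ks) = 0"
| "monomial_qsym (t # ts) (k # ks) = monomial_qsym ts (k # ks) + t ^ k * monomial_qsym ts ks"

text \<open>The value is kept as a constant coefficient so that \<open>linext\<close>, whose values
  are polynomials, supplies linearity.\<close>

definition eval :: "rat list \<Rightarrow> ncpoly \<Rightarrow> rat" where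
  "eval ts p = Poly_Mapping.lookup (linext (\<lambda>w. scal (monomial_qsym ts (z_indices w)) 1) p) 0"

lemma lookup_scal: "Poly_Mapping.lookup (scal c p) w = c * Poly_Mapping.lookup p w"
proof (induction p rule: ncpoly_induct)
  case (single u b)
  then show ?case by (simp add: scal_single lookup_single when_def)
next
  case (sum p q)
  then show ?case by (simp add: scal_add_right lookup_add distrib_left)
qed

lemma eval_add: "eval ts (p + q) = eval ts p + eval ts q"
  by (simp add: eval_def linext_add lookup_add)

lemma eval_scal: "eval ts (scal c p) = c * eval ts p"
  by (simp add: eval_def linext_scal lookup_scal)

lemma eval_mon: "eval ts (mon w) = monomial_qsym ts (z_indices w)"
  by (simp add: eval_def lookup_scal)

lemma eval_single: "eval ts (Poly_Mapping.single w c) = c * monomial_qsym ts (z_indices w)"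
  using eval_scal[of ts c "mon w"] by (simp add: eval_mon) (simp add: mon_def scal_single)

lemma eval_0: "eval ts 0 = 0"
  using eval_add[of ts 0 0] by simp

lemma eval_diff: "eval ts (p - q) = eval ts p - eval ts q"
  using eval_add[of ts "p - q" q] by simp

lemma eval_sum: "eval ts (sum f A) = (\<Sum>x\<in>A. eval ts (f x))"
  by (induction A rule: infinite_finite_induct) (simp_all add: eval_0 eval_add)

lemma eval_numeral_mult: "eval ts (numeral m * p) = numeral m * eval ts p"
proof -
  have "eval ts (of_nat k * p) = of_nat k * eval ts p" for k
    by (induction k) (simp_all add: eval_0 eval_add distrib_right)
  from this[of "numeral m"] show ?thesis by simp
qed

lemma eval_expand:
  "eval ts p = (\<Sum>w\<in>Poly_Mapping.keys p. Poly_Mapping.lookup p w * monomial_qsym ts (z_indices w))"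
  by (simp add: eval_def linext_def lookup_sum lookup_scal)

lemma eval_linext: "eval ts (linext f p) =
    (\<Sum>w\<in>Poly_Mapping.keys p. Poly_Mapping.lookup p w * eval ts (f w))"
  by (simp add: linext_def eval_sum eval_scal)

lemma z_indices_from_pos: "0 \<notin> set (z_indices_from m w)"
  by (induction m w rule: z_indices_from.induct) auto

lemma z_indices_from_add:
  "z_indices_from m (w @ [Letter_y]) \<noteq> [] \<and>
   z_indices_from (m + k) (w @ [Letter_y]) =
     (k + hd (z_indices_from m (w @ [Letter_y]))) # tl (z_indices_from m (w @ [Letter_y]))"
  by (induction m w rule: z_indices_from.induct) auto

lemma eval_z_prod: "0 \<notin> set ks \<Longrightarrow> eval ts (z_prod ks) = monomial_qsym ts ks"
  by (simp add: z_prod_eq eval_mon z_indices_z_word)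

lemma eval_1: "eval ts 1 = 1"
  using eval_z_prod[of "[]"] by simp

lemma eval_Nil_z_mult: "eval [] (z k * p) = 0"
proof (induction p rule: ncpoly_induct)
  case (single w c)
  then show ?case
    by (simp add: z_eq mon_def mult_single eval_single plus_word_def z_indices_def z_indices_from_append)
next
  case (sum p q)
  then show ?case by (simp add: distrib_left eval_add)
qed

lemma eval_Cons_z_mult:
  assumes "k > 0"
  shows "eval (t # ts) (z k * p) = eval ts (z k * p) + t ^ k * eval ts p"
proof (induction p rule: ncpoly_induct)
  case (single w c)
  then show ?case using assms
    by (simp add: z_eq mon_def mult_single eval_single plus_word_def z_indices_def
        z_indices_from_append algebra_simps)
next
  case (sum p q)
  then show ?case by (simp add: eval_add algebra_simps)
qed

lemma eval_Cons_z: "k > 0 \<Longrightarrow> eval (t # ts) (z k) = eval ts (z k) + t ^ k"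
  using eval_Cons_z_mult[of k t ts 1] by (simp add: eval_1)

text \<open>Prefixing \<open>px ^ k\<close> raises the first index by \<open>k\<close>, so exactly
  the terms in which \<open>t\<close> takes the first letter gain \<open>t ^ k\<close>; the
  difference collects these terms.\<close>

lemma eval_Cons_px_power_mult:
  "eval (t # ts) (px ^ k * (p * py)) =
    eval ts (px ^ k * (p * py)) + t ^ k * (eval (t # ts) (p * py) - eval ts (p * py))"
proof (induction p rule: ncpoly_induct)
  case (single w c)
  obtain l ls where *: "z_indices_from 0 (letters w @ [Letter_y]) = l # ls"
    "z_indices_from k (letters w @ [Letter_y]) = (k + l) # ls"
    using z_indices_from_add[of 0 "letters w" k]
    by (cases "z_indices_from 0 (letters w @ [Letter_y])") auto
  then show ?case
    by (simp add: px_power py_def mon_def mult_single eval_single plus_word_def z_indices_def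
        z_indices_from_append algebra_simps power_add)
next
  case (sum p q)
  then show ?case by (simp add: eval_add algebra_simps)
qed

section \<open>The harmonic product becomes multiplication\<close>

text \<open>In the product of two values \<open>t\<close> takes the first letter of neither word, of
  one, or of both: this is the recursion of \<open>harmonic_indices\<close>.\<close>

lemma eval_harmonic_indices:
  "0 \<notin> set ks \<Longrightarrow> 0 \<notin> set ls \<Longrightarrow>
    eval ts (harmonic_indices ks ls) = monomial_qsym ts ks * monomial_qsym ts ls"
proof (induction ts arbitrary: ks ls)
  case Nil
  then show ?case
    by (cases ks; cases ls) (simp_all add: eval_add eval_Nil_z_mult eval_1)
next
  case (Cons t ts)
  show ?case
  proof (cases "ks = [] \<or> ls = []")
    case True
    then have "harmonic_indices ks ls = z_prod (ks @ ls)"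
      by (cases ks) auto
    then show ?thesis using True Cons.prems by (auto simp: eval_z_prod simp del: z_prod_Cons)
  next
    case False
    then obtain k ks' l ls' where *: "ks = k # ks'" "ls = l # ls'"
      by (meson neq_Nil_conv)
    have "eval (t # ts) (harmonic_indices ks ls) = eval ts (harmonic_indices ks ls)
        + t ^ k * eval ts (harmonic_indices ks' ls) + t ^ l * eval ts (harmonic_indices ks ls')
        + t ^ (k + l) * eval ts (harmonic_indices ks' ls')"
      using Cons.prems by (simp add: * eval_add eval_Cons_z_mult)
    also have "\<dots> = monomial_qsym ts ks * monomial_qsym ts ls
        + t ^ k * (monomial_qsym ts ks' * monomial_qsym ts ls)
        + t ^ l * (monomial_qsym ts ks * monomial_qsym ts ls')
        + t ^ (k + l) * (monomial_qsym ts ks' * monomial_qsym ts ls')"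
      using Cons.prems Cons.IH[of ks ls] Cons.IH[of ks' ls] Cons.IH[of ks ls'] Cons.IH[of ks' ls']
      by (simp add: * del: harmonic_indices.simps)
    also have "\<dots> = monomial_qsym (t # ts) ks * monomial_qsym (t # ts) ls"
      by (simp add: * algebra_simps power_add)
    finally show ?thesis .
  qed
qed

lemma eval_harmonic: "eval ts (p \<star> q) = eval ts p * eval ts q"
  unfolding eval_expand[of ts p] eval_expand[of ts q] sum_product
  by (simp add: harmonic_def eval_linext eval_harmonic_indices z_indices_def z_indices_from_pos
      sum_distrib_left mult_ac)

section \<open>Faithfulness of evaluation on \<open>H1\<close>\<close>

text \<open>Subtracting the relation at \<open>ts\<close> from that at \<open>t # ts\<close> leaves
  a polynomial in \<open>t\<close> that vanishes identically; its coefficient at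
  \<open>t ^ k\<close> is a relation among the tails of the words starting with
  \<open>k\<close>.\<close>

lemma monomial_qsym_independent:
  assumes "finite A" and "\<And>ts. (\<Sum>w\<in>A. f w * monomial_qsym ts w) = 0" and "w \<in> A"
  shows "f w = 0"
  using assms
proof (induction w arbitrary: A f)
  case Nil
  have *: "f w * monomial_qsym [] w = (if w = [] then f w else 0)" for w
    by (cases w) simp_all
  show ?case
    using Nil.prems(2)[of "[]"] Nil.prems(1,3) unfolding * by simp
next
  case (Cons k w)
  let ?B = "{w. k # w \<in> A}"
  have "?B = tl ` {u \<in> A. \<exists>v. u = k # v}" by force
  with Cons.prems(1) have "finite ?B" by simp
  moreover have "(\<Sum>w\<in>?B. f (k # w) * monomial_qsym ts w) = 0" for ts
  proof -
    let ?A = "A - {[]}"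
    define P :: "rat poly" where "P = (\<Sum>u\<in>?A. monom (f u * monomial_qsym ts (tl u)) (hd u))"
    have "poly P t = 0" for t
    proof -
      have "0 = (\<Sum>u\<in>A. f u * monomial_qsym (t # ts) u) - (\<Sum>u\<in>A. f u * monomial_qsym ts u)"
        using Cons.prems(2) by simp
      also have "\<dots> = (\<Sum>u\<in>A. f u * (monomial_qsym (t # ts) u - monomial_qsym ts u))"
        by (simp add: sum_subtractf algebra_simps)
      also have "\<dots> = (\<Sum>u\<in>?A. f u * (monomial_qsym (t # ts) u - monomial_qsym ts u))"
        using Cons.prems(1) by (intro sum.mono_neutral_right) auto
      also have "\<dots> = (\<Sum>u\<in>?A. f u * monomial_qsym ts (tl u) * t ^ hd u)"
        by (intro sum.cong) (auto simp: neq_Nil_conv)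
      also have "\<dots> = poly P t"
        by (simp add: P_def poly_sum poly_monom)
      finally show ?thesis by simp
    qed
    then have "P = 0" using poly_all_0_iff_0 by blast
    then have "0 = coeff P k" by simp
    also have "\<dots> = (\<Sum>u\<in>?A. if hd u = k then f u * monomial_qsym ts (tl u) else 0)"
      by (simp add: P_def coeff_sum)
    also have "\<dots> = (\<Sum>u\<in>{u\<in>?A. hd u = k}. f u * monomial_qsym ts (tl u))"
      using Cons.prems(1) by (intro sum.inter_filter[symmetric]) simp
    also have "\<dots> = (\<Sum>w\<in>?B. f (k # w) * monomial_qsym ts w)"
      by (rule sum.reindex_bij_witness[of _ "\<lambda>w. k # w" tl]) auto
    finally show ?thesis by simp
  qed
  ultimately show ?case
    using Cons.IH[of ?B "\<lambda>w. f (k # w)"] Cons.prems(3) by simp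
qed

lemma H1_diff:
  assumes "p \<in> H1" "q \<in> H1"
  shows "p - q \<in> H1"
proof -
  have "scal (- 1) q = - q"
    using scal_add[of "- 1" 1 q] by (simp add: eq_neg_iff_add_eq_0)
  then show ?thesis
    using H1_add[OF assms(1) H1_scal[OF assms(2), of "- 1"]] by simp
qed

lemma H1_0: "0 \<in> H1"
  by (simp add: H1_iff)

lemma H1_sum: "(\<And>x. x \<in> A \<Longrightarrow> f x \<in> H1) \<Longrightarrow> sum f A \<in> H1"
  by (induction A rule: infinite_finite_induct) (auto simp: H1_0 intro: H1_add)

lemma H1_numeral_mult:
  assumes "p \<in> H1"
  shows "numeral m * p \<in> H1"
proof -
  have "of_nat k * p \<in> H1" for k
    by (induction k) (simp_all add: H1_0 H1_add assms distrib_right)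
  from this[of "numeral m"] show ?thesis by simp
qed

text \<open>Words in elements of \<open>H1\<close> are recovered from their index lists, so the
  independence of \<open>monomial_qsym\<close> applies to the difference.\<close>

lemma eval_eqI:
  assumes "p \<in> H1" "q \<in> H1" "\<And>ts. eval ts p = eval ts q"
  shows "p = q"
proof -
  have H1: "p - q \<in> H1"
    using assms by (intro H1_diff)
  let ?K = "Poly_Mapping.keys (p - q)"
  have w: "z_word (z_indices w) = w" if "w \<in> ?K" for w
    using H1 that by (auto simp: H1_iff z_word_z_indices)
  then have inj: "inj_on z_indices ?K" by (metis inj_onI)
  have "Poly_Mapping.lookup (p - q) w = 0" if "w \<in> ?K" for w
  proof -
    have "(\<Sum>ks\<in>z_indices ` ?K. Poly_Mapping.lookup (p - q) (z_word ks) * monomial_qsym ts ks) = 0" for ts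
      using assms(3)[of ts] eval_diff[of ts p q] w
      by (simp add: sum.reindex[OF inj] eval_expand)
    then show ?thesis
      using monomial_qsym_independent[of "z_indices ` ?K"
          "\<lambda>ks. Poly_Mapping.lookup (p - q) (z_word ks)" "z_indices w"] that w
      by simp
  qed
  then have "?K = {}" using in_keys_iff by blast
  then have "p - q = 0" by (simp only: keys_eq_empty)
  then show ?thesis by simp
qed

section \<open>Evaluation after \<open>d\<close>\<close>

text \<open>As \<open>gamma_map\<close> sends \<open>z k\<close> to
  \<open>px ^ (k - 1) * (px + py)\<close>, \<open>d\<close> keeps the letter or, as
  \<open>px ^ k\<close>, merges it with the next one.\<close>

lemma d_z: "d (z k) = z k"
  and d_z_mult_py: "k > 0 \<Longrightarrow> d (z k * (q * py)) = z k * d (q * py) + px ^ k * d (q * py)"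
proof -
  have *: "gamma_map (px ^ m) = px ^ m" for m
    by (induction m) (simp_all add: gamma_map_1 gamma_map_mult gamma_map_px)
  then show "d (z k) = z k"
    by (simp add: z_def d_mult_py)
  show "d (z k * (q * py)) = z k * d (q * py) + px ^ k * d (q * py)" if "k > 0"
  proof -
    have "d (z k * (q * py)) = gamma_map (z k * q) * py"
      by (simp add: d_mult_py flip: mult.assoc)
    also have "gamma_map (z k * q) = (z k + px ^ k) * gamma_map q"
      using that
      by (cases k) (simp_all add: z_def gamma_map_mult * gamma_map_py distrib_left power_commutes
          add.commute del: power_Suc add: power_Suc2)
    finally show ?thesis
      by (simp add: d_mult_py algebra_simps)
  qed
qed

text \<open>Merging lets \<open>t\<close> serve the next letter too, so the rest is evaluated at
  \<open>t # ts\<close> again: indices increase weakly.\<close>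

lemma eval_Cons_d_z_mult:
  assumes "p \<in> H1" "k > 0"
  shows "eval (t # ts) (d (z k * p)) = eval ts (d (z k * p)) + t ^ k * eval (t # ts) (d p)"
proof -
  \<comment> \<open>The constant term is split off because a last letter has no successor to merge
    with.\<close>
  obtain c q where p: "p = scal c 1 + q * py"
    using assms(1) by (auto simp: H1_def)
  have d: "d (z k * p) = scal c (z k) + (z k * d (q * py) + px ^ k * d (q * py))"
    using assms(2) by (simp add: p distrib_left scal_mult_right d_add d_scal d_z d_z_mult_py)
  show ?thesis
    using assms(2) unfolding d
    by (simp add: eval_add eval_scal eval_Cons_z eval_Cons_z_mult d_mult_py eval_Cons_px_power_mult)
      (simp add: p d_add d_scal d_1 d_mult_py eval_add eval_scal eval_1 algebra_simps)
qed

lemma eval_Nil_d_z_mult: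
  assumes "p \<in> H1" "k > 0"
  shows "eval [] (d (z k * p)) = 0"
proof -
  obtain c q where p: "p = scal c 1 + q * py"
    using assms(1) by (auto simp: H1_def)
  have "eval [] (px ^ k * (r * py)) = 0" for r
  proof (induction r rule: ncpoly_induct)
    case (single w c)
    obtain l ls where "z_indices_from k (letters w @ [Letter_y]) = l # ls"
      using z_indices_from_add[of 0 "letters w" k] by auto
    then show ?case
      by (simp add: px_power py_def mon_def mult_single eval_single plus_word_def z_indices_def
          z_indices_from_append)
  next
    case (sum p q)
    then show ?case by (simp add: eval_add algebra_simps)
  qed
  then show ?thesis
    using assms(2) eval_Nil_z_mult[of k 1]
    by (simp add: p distrib_left scal_mult_right d_add d_scal d_z d_z_mult_py eval_add eval_scal
        eval_Nil_z_mult d_mult_py)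
qed

section \<open>Words with alternating letters\<close>

lemma z_prod_replicate: "z_prod (replicate i c) = z c ^ i"
  by (induction i) simp_all

lemma H1_z_power: "z k ^ n \<in> H1"
  using H1_z_prod[of "replicate n k"] by (simp add: z_prod_replicate)

lemma z_prod_alternating: "z_prod (concat (replicate n [a, b])) = (z a * z b) ^ n"
  by (induction n) (simp_all add: mult.assoc)

text \<open>
  \<open>D\<close>, \<open>S\<close> stand for the sides with and without \<^const>\<open>d\<close>, \<open>e\<close>, \<open>o\<close> for even and odd alternating
  words, the digit for the number of letters \<open>z\<^sub>c\<close>, and a prime for one more variable. Since even
  and odd play symmetric roles, the conclusion for \<open>o\<close> is the one for \<open>e\<close> with
  \<open>\<alpha>\<close> and \<open>\<beta>\<close> exchanged.
\<close>

lemma transfer_step: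
  fixes q :: "'a :: idom"
  assumes q: "1 - q \<noteq> 0" "q = \<alpha> * \<beta>"
    and D0: "De0' = De0 + \<alpha> * Do0'" "Do0' = Do0 + \<beta> * De0'"
    and D1: "De1' = De1 + s * De0' + \<alpha> * Do1'" "Do1' = Do1 + s * Do0' + \<beta> * De1'"
    and D2: "De2' = De2 + s * De1' + \<alpha> * Do2'" "Do2' = Do2 + s * Do1' + \<beta> * De2'"
    and S0: "Se0' = Se0 + \<alpha> * So0"
    and S1: "Se1' = Se1 + s * Se0 + \<alpha> * So1"
    and S2: "Se2' = Se2 + s * Se1 + \<alpha> * So2"
    and h: "(1 - q) * h' = h" and g: "(1 - q) * g = s"
    and e0: "De0 = h * Se0" and o0: "Do0 = h * So0"
    and e1: "De1 = 2 * De0 * p - h * Se1" and o1: "Do1 = 2 * Do0 * p - h * So1"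
    and e2: "De2 = 2 * De1 * p + h * Se2 - 4 * De0 * r - De0 * m"
    and o2: "Do2 = 2 * Do1 * p + h * So2 - 4 * Do0 * r - Do0 * m"
  shows "De0' = h' * Se0'"
    and "De1' = 2 * De0' * (p + g) - h' * Se1'"
    and "De2' = 2 * De1' * (p + g) + h' * Se2' - 4 * De0' * (r + g * p) - De0' * (m + s * g)"
proof -
  have D0': "(1 - q) * De0' = De0 + \<alpha> * Do0"
    using q(2) D0 by algebra
  have "(1 - q) * De0' = (1 - q) * (h' * Se0')"
    using D0' S0 h e0 o0 by algebra
  then show "De0' = h' * Se0'" using q(1) by simp
  have D1': "(1 - q) * De1' = De1 + \<alpha> * Do1 + s * (De0' + \<alpha> * Do0')"
    using q(2) D1 by algebra
  \<comment> \<open>The factor \<open>2 * De0' - De0\<close> comes from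
    \<open>\<alpha> * Do0' = De0' - De0\<close>.\<close>
  have "(1 - q) * De1' = 2 * p * (De0 + \<alpha> * Do0) - h * (Se1 + \<alpha> * So1) + s * (2 * De0' - De0)"
    using D1' e1 o1 D0(1) by algebra
  also have "\<dots> = 2 * p * ((1 - q) * De0') - h * Se1' + 2 * s * De0'"
    using D0' S1 e0 by algebra
  also have "\<dots> = (1 - q) * (2 * De0' * (p + g) - h' * Se1')"
    unfolding g[symmetric] h[symmetric] by (simp add: algebra_simps)
  finally show "De1' = 2 * De0' * (p + g) - h' * Se1'" using q(1) by simp
  have D2': "(1 - q) * De2' = De2 + \<alpha> * Do2 + s * (De1' + \<alpha> * Do1')"
    using q(2) D2 by algebra
  have "De2 + \<alpha> * Do2 = 2 * p * (De1 + \<alpha> * Do1) + h * (Se2 + \<alpha> * So2) - (4 * r + m) * (De0 + \<alpha> * Do0)"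
    using e2 o2 by algebra
  also have "\<dots> = 2 * p * ((1 - q) * De1' - s * (2 * De0' - De0)) + h * Se2' - h * s * Se1
      - (4 * r + m) * ((1 - q) * De0')"
    using D1' D0' S2 D0(1) by algebra
  finally have "(1 - q) * De2' = 2 * p * ((1 - q) * De1') + h * Se2' - (4 * r + m) * ((1 - q) * De0')
      + s * (2 * De1' - De1 - s * De0' - h * Se1 - 2 * p * (2 * De0' - De0))"
    using D2' D1(1) by algebra
  \<comment> \<open>By \<open>e1\<close>, \<open>De1 + h * Se1\<close> is
    \<open>2 * De0 * p\<close>, so \<open>De0\<close> and \<open>De1\<close> leave the
    bracket.\<close>
  also have "\<dots> = 2 * p * ((1 - q) * De1') + h * Se2' - (4 * r + m) * ((1 - q) * De0')
      + s * (2 * De1' - s * De0' - 4 * p * De0')"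
    using e1 by algebra
  also have "\<dots> = (1 - q) * (2 * De1' * (p + g) + h' * Se2' - 4 * De0' * (r + g * p) - De0' * (m + s * g))"
    unfolding g[symmetric] h[symmetric] by (simp add: algebra_simps)
  finally show "De2' = 2 * De1' * (p + g) + h' * Se2' - 4 * De0' * (r + g * p) - De0' * (m + s * g)"
    using q(1) by simp
qed

lemma sum_pairs_nat:
  "(\<Sum>(j, k)\<in>{(j, k). j + k = n}. f j k) = (\<Sum>j=0..n::nat. f j (n - j))"
  by (rule sum.reindex_bij_witness[of _ "\<lambda>j. (j, n - j)" fst]) auto

lemma sum_triples_nat:
  "(\<Sum>(i, j, k)\<in>{(i, j, k). i + j + k = n}. f i j k) =
    (\<Sum>i=0..n::nat. \<Sum>j=0..n - i. f i j (n - i - j))"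
  unfolding sum.Sigma[OF finite_atLeastAtMost ballI[OF finite_atLeastAtMost]]
  by (rule sum.reindex_bij_witness[of _ "\<lambda>(i, j). (i, j, n - i - j)" "\<lambda>(i, j, k). (i, j)"]) auto

lemma fps_numeral_mult_nth: "fps_nth (numeral m * f) n = numeral m * fps_nth f n"
  by (simp add: numeral_fps_const)

section \<open>Recursions for the alternating shuffles\<close>

context
  fixes a b c :: nat
  assumes pos: "a > 0" "b > 0" "c > 0"
begin

definition even_word :: "nat \<Rightarrow> nat \<Rightarrow> ncpoly" where
  "even_word i n = z c ^ i \<diamondop> (z a * z b) ^ n"

definition odd_word :: "nat \<Rightarrow> nat \<Rightarrow> ncpoly" where
  "odd_word i n = z c ^ i \<diamondop> (z b * (z a * z b) ^ n)"

lemma H1_even_word: "even_word i n \<in> H1" and H1_odd_word: "odd_word i n \<in> H1"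
  by (simp_all add: even_word_def odd_word_def H1_zshuffle)

text \<open>A shuffled word begins with \<open>z c\<close> or with the first letter of the
  alternating word, whose removal exchanges even and odd.\<close>

lemma alternating_rec:
  shows even_word_0: "even_word 0 n = (z a * z b) ^ n"
    and odd_word_0: "odd_word 0 n = z b * even_word 0 n"
    and even_word_0_Suc: "even_word 0 (Suc n) = z a * odd_word 0 n"
    and even_word_Suc_0: "even_word (Suc i) 0 = z c * even_word i 0"
    and even_word_Suc_Suc:
      "even_word (Suc i) (Suc n) = z c * even_word i (Suc n) + z a * odd_word (Suc i) n"
    and odd_word_Suc: "odd_word (Suc i) n = z c * odd_word i n + z b * even_word (Suc i) n"
proof -
  let ?e = "\<lambda>n. concat (replicate n [a, b])"
  have nz: "0 \<notin> set (?e n)" "0 \<notin> set (replicate i c)" for n i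
    using pos by auto
  have e: "(z a * z b) ^ n = z_prod (?e n)" for n
    by (simp add: z_prod_alternating)
  have c: "z c ^ i = z_prod (replicate i c)" for i
    by (simp add: z_prod_replicate)
  show e0: "even_word 0 n = (z a * z b) ^ n" for n
    using nz one_zshuffle[of "?e n"] by (simp add: even_word_def e)
  show o0: "odd_word 0 n = z b * even_word 0 n" for n
    using nz pos one_zshuffle[of "b # ?e n"] unfolding e0 by (simp add: odd_word_def e)
  show "even_word 0 (Suc n) = z a * odd_word 0 n"
    by (simp add: e0 o0 mult.assoc)
  show "even_word (Suc i) 0 = z c * even_word i 0"
    using zshuffle_one[OF nz(2), of i] zshuffle_one[OF nz(2), of "Suc i"]
    by (simp add: even_word_def c)
  show "even_word (Suc i) (Suc n) = z c * even_word i (Suc n) + z a * odd_word (Suc i) n"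
    using zshuffle_Cons[of c "replicate i c" a "b # ?e n"] nz pos
    by (simp add: even_word_def odd_word_def c e mult.assoc del: power_Suc)
  show "odd_word (Suc i) n = z c * odd_word i n + z b * even_word (Suc i) n"
    using zshuffle_Cons[of c "replicate i c" b "?e n"] nz pos
    by (simp add: even_word_def odd_word_def c e del: power_Suc)
qed

text \<open>The variable of the power series is \<open>u\<^sup>2\<close>, marking pairs of letters \<open>z\<^sub>a z\<^sub>b\<close>; the unpaired \<open>z\<^sub>b\<close> of an
  odd word is not counted.\<close>

definition even_gf :: "(ncpoly \<Rightarrow> rat) \<Rightarrow> nat \<Rightarrow> rat fps" where
  "even_gf L i = Abs_fps (\<lambda>n. L (even_word i n))"

definition odd_gf :: "(ncpoly \<Rightarrow> rat) \<Rightarrow> nat \<Rightarrow> rat fps" where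
  "odd_gf L i = Abs_fps (\<lambda>n. L (odd_word i n))"

text \<open>\<open>M = L\<close> is the case of plain evaluation, \<open>M = L'\<close> that of evaluation after \<^const>\<open>d\<close>, where
  the new variable may occur repeatedly.\<close>

lemma gf_transfer:
  assumes add: "\<And>p q. L (p + q) = L p + L q" "\<And>p q. L' (p + q) = L' p + L' q"
    and one: "L' 1 = L 1"
    and z: "\<And>k p. p \<in> H1 \<Longrightarrow> k > 0 \<Longrightarrow> L' (z k * p) = L (z k * p) + t ^ k * M p"
  shows "even_gf L' 0 = even_gf L 0 + fps_X * fps_const (t ^ a) * odd_gf M 0"
    and "odd_gf L' 0 = odd_gf L 0 + fps_const (t ^ b) * even_gf M 0"
    and "even_gf L' (Suc i) = even_gf L (Suc i) + fps_const (t ^ c) * even_gf M i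
           + fps_X * fps_const (t ^ a) * odd_gf M (Suc i)"
    and "odd_gf L' (Suc i) = odd_gf L (Suc i) + fps_const (t ^ c) * odd_gf M i
           + fps_const (t ^ b) * even_gf M (Suc i)"
proof -
  note simps = even_gf_def odd_gf_def mult.assoc add z pos H1_even_word H1_odd_word
  show "even_gf L' 0 = even_gf L 0 + fps_X * fps_const (t ^ a) * odd_gf M 0"
  proof (rule fps_ext)
    fix n
    show "fps_nth (even_gf L' 0) n =
      fps_nth (even_gf L 0 + fps_X * fps_const (t ^ a) * odd_gf M 0) n"
      by (cases n) (simp_all add: simps even_word_0_Suc, simp add: even_word_0 one)
  qed
  show "odd_gf L' 0 = odd_gf L 0 + fps_const (t ^ b) * even_gf M 0"
    by (rule fps_ext) (simp add: simps odd_word_0)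
  show "even_gf L' (Suc i) = even_gf L (Suc i) + fps_const (t ^ c) * even_gf M i
           + fps_X * fps_const (t ^ a) * odd_gf M (Suc i)"
  proof (rule fps_ext)
    fix n
    show "fps_nth (even_gf L' (Suc i)) n =
      fps_nth (even_gf L (Suc i) + fps_const (t ^ c) * even_gf M i
        + fps_X * fps_const (t ^ a) * odd_gf M (Suc i)) n"
      by (cases n) (simp_all add: simps even_word_Suc_0 even_word_Suc_Suc)
  qed
  show "odd_gf L' (Suc i) = odd_gf L (Suc i) + fps_const (t ^ c) * odd_gf M i
           + fps_const (t ^ b) * even_gf M (Suc i)"
    by (rule fps_ext) (simp add: simps odd_word_Suc)
qed

lemma gf_base:
  assumes add: "\<And>p q. L (p + q) = L p + L q"
    and one: "L 1 = 1"
    and z: "\<And>k p. p \<in> H1 \<Longrightarrow> k > 0 \<Longrightarrow> L (z k * p) = 0"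
  shows "even_gf L i = of_bool (i = 0)" "odd_gf L i = 0"
proof -
  note simps = even_gf_def odd_gf_def add z pos H1_even_word H1_odd_word
  have "L (odd_word i n) = 0" for n
    by (cases i) (simp_all add: simps odd_word_0 odd_word_Suc)
  then show "odd_gf L i = 0"
    by (simp add: odd_gf_def fps_eq_iff)
  show "even_gf L i = of_bool (i = 0)"
  proof (rule fps_ext)
    fix n
    show "fps_nth (even_gf L i) n = fps_nth (of_bool (i = 0)) n"
      by (cases i; cases n)
        (simp_all add: simps even_word_0_Suc even_word_Suc_0 even_word_Suc_Suc,
         simp add: even_word_0 one)
  qed
qed

section \<open>Generating functions of the other factors\<close>

text \<open>After \<open>d\<close>, powers of one letter evaluate to complete homogeneous symmetric
  functions of the numbers \<open>t ^ (a + b)\<close>; hence a product of geometric series.\<close>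

definition d_power_gf :: "rat list \<Rightarrow> rat fps" where
  "d_power_gf ts = Abs_fps (\<lambda>n. eval ts (d (z (a + b) ^ n)))"

definition z_gf :: "nat \<Rightarrow> rat list \<Rightarrow> rat fps" where
  "z_gf l ts = Abs_fps (\<lambda>n. eval ts (z ((a + b) * n + l)))"

text \<open>The second elementary symmetric function of the series
  \<open>geom_gf c t\<close>.\<close>

definition z_pair_gf :: "rat list \<Rightarrow> rat fps" where
  "z_pair_gf ts = Abs_fps (\<lambda>n. \<Sum>j=0..n. eval ts (z ((a + b) * j + c) * z ((a + b) * (n - j) + c)))"

definition geom_gf :: "nat \<Rightarrow> rat \<Rightarrow> rat fps" where
  "geom_gf l t = Abs_fps (\<lambda>n. t ^ ((a + b) * n + l))"

lemma geom_gf_mult: "(1 - fps_X * fps_const (t ^ (a + b))) * geom_gf l t = fps_const (t ^ l)"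
proof (rule fps_ext)
  fix n
  show "fps_nth ((1 - fps_X * fps_const (t ^ (a + b))) * geom_gf l t) n =
    fps_nth (fps_const (t ^ l)) n"
    by (cases n) (simp_all add: geom_gf_def algebra_simps power_add)
qed

lemma geom_gf_add: "geom_gf (k + l) t = fps_const (t ^ k) * geom_gf l t"
  by (rule fps_ext) (simp add: geom_gf_def power_add)

lemma d_power_gf_Nil: "d_power_gf [] = 1"
proof (rule fps_ext)
  fix n
  show "fps_nth (d_power_gf []) n = fps_nth 1 n"
    using pos by (cases n) (simp_all add: d_power_gf_def d_1 eval_1 eval_Nil_d_z_mult H1_z_power)
qed

lemma d_power_gf_Cons:
  "(1 - fps_X * fps_const (t ^ (a + b))) * d_power_gf (t # ts) = d_power_gf ts"
proof (rule fps_ext)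
  fix n
  show "fps_nth ((1 - fps_X * fps_const (t ^ (a + b))) * d_power_gf (t # ts)) n = fps_nth (d_power_gf ts) n"
    using pos by (cases n)
      (simp_all add: d_power_gf_def d_1 eval_1 eval_Cons_d_z_mult H1_z_power left_diff_distrib mult.assoc)
qed

lemma z_gf_Nil: "z_gf l [] = 0"
  using eval_Nil_z_mult[of _ 1] by (simp add: z_gf_def fps_eq_iff)

lemma z_gf_Cons: "l > 0 \<Longrightarrow> z_gf l (t # ts) = z_gf l ts + geom_gf l t"
  by (rule fps_ext) (simp add: z_gf_def geom_gf_def eval_Cons_z)

lemma z_pair_gf_Nil: "z_pair_gf [] = 0"
  by (simp add: z_pair_gf_def fps_eq_iff eval_Nil_z_mult)

lemma z_pair_gf_Cons: "z_pair_gf (t # ts) = z_pair_gf ts + geom_gf c t * z_gf c ts"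
  by (rule fps_ext)
    (use pos in \<open>simp add: z_pair_gf_def geom_gf_def z_gf_def fps_mult_nth eval_Cons_z_mult sum.distrib\<close>)

section \<open>Induction on the variables and comparison of coefficients\<close>

text \<open>All three orders and both parities are proved together, since
  \<open>transfer_step\<close> uses the lower orders and the other parity.\<close>

lemma gf_identities:
  defines "D \<equiv> \<lambda>ts p. eval ts (d p)"
  shows "even_gf (D ts) 0 = d_power_gf ts * even_gf (eval ts) 0 \<and>
    odd_gf (D ts) 0 = d_power_gf ts * odd_gf (eval ts) 0 \<and>
    even_gf (D ts) 1 = 2 * even_gf (D ts) 0 * z_gf c ts - d_power_gf ts * even_gf (eval ts) 1 \<and>
    odd_gf (D ts) 1 = 2 * odd_gf (D ts) 0 * z_gf c ts - d_power_gf ts * odd_gf (eval ts) 1 \<and>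
    even_gf (D ts) 2 = 2 * even_gf (D ts) 1 * z_gf c ts + d_power_gf ts * even_gf (eval ts) 2
      - 4 * even_gf (D ts) 0 * z_pair_gf ts - even_gf (D ts) 0 * z_gf (2 * c) ts \<and>
    odd_gf (D ts) 2 = 2 * odd_gf (D ts) 1 * z_gf c ts + d_power_gf ts * odd_gf (eval ts) 2
      - 4 * odd_gf (D ts) 0 * z_pair_gf ts - odd_gf (D ts) 0 * z_gf (2 * c) ts"
proof (induction ts)
  case Nil
  have D: "even_gf (D []) i = of_bool (i = 0)" "odd_gf (D []) i = 0" for i
    by (rule gf_base; simp add: D_def d_add eval_add d_1 eval_1 eval_Nil_d_z_mult)+
  have S: "even_gf (eval []) i = of_bool (i = 0)" "odd_gf (eval []) i = 0" for i
    by (rule gf_base; simp add: eval_add eval_1 eval_Nil_z_mult)+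
  show ?case
    by (simp add: D S d_power_gf_Nil z_gf_Nil z_pair_gf_Nil)
next
  case (Cons t ts)
  \<comment> \<open>Only \<open>?\<alpha>\<close> carries \<open>fps_X\<close>: removing
    \<open>z a\<close> from an even word breaks up a pair, removing the unpaired \<open>z b\<close>
    from an odd word does not.\<close>
  let ?\<alpha> = "fps_X * fps_const (t ^ a)" and ?\<beta> = "fps_const (t ^ b)" and ?s = "fps_const (t ^ c)"
  let ?q = "fps_X * fps_const (t ^ (a + b))"
  have Dadd: "D us (p + q) = D us p + D us q" and Done: "D us 1 = 1" for us p q
    by (simp_all add: D_def d_add eval_add d_1 eval_1)
  have Dz: "D (t # ts) (z k * p) = D ts (z k * p) + t ^ k * D (t # ts) p" if "p \<in> H1" "k > 0" for k p
    using that by (simp add: D_def eval_Cons_d_z_mult)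
  note tD = gf_transfer[of "D ts" "D (t # ts)" t "D (t # ts)", OF Dadd Dadd _ Dz, unfolded Done, OF refl]
  note tS = gf_transfer[of "eval ts" "eval (t # ts)" t "eval ts", OF eval_add eval_add _ eval_Cons_z_mult,
      unfolded eval_1, OF refl]
  have q: "1 - ?q \<noteq> 0"
  proof
    assume "1 - ?q = 0"
    then have "fps_nth (1 - ?q) 0 = 0" by simp
    then show False by simp
  qed
  have q': "?q = ?\<alpha> * ?\<beta>" "?q = ?\<beta> * ?\<alpha>"
    by (simp_all add: power_add mult_ac flip: fps_const_mult)
  have g2: "z_gf (2 * c) (t # ts) = z_gf (2 * c) ts + ?s * geom_gf c t"
    using pos geom_gf_add[of c c t] by (simp add: z_gf_Cons mult_2)
  note g = z_gf_Cons[OF pos(3)] z_pair_gf_Cons g2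
  note IH = Cons.IH[THEN conjunct1] Cons.IH[THEN conjunct2, THEN conjunct1]
    Cons.IH[THEN conjunct2, THEN conjunct2, THEN conjunct1]
    Cons.IH[THEN conjunct2, THEN conjunct2, THEN conjunct2, THEN conjunct1]
    Cons.IH[THEN conjunct2, THEN conjunct2, THEN conjunct2, THEN conjunct2, THEN conjunct1]
    Cons.IH[THEN conjunct2, THEN conjunct2, THEN conjunct2, THEN conjunct2, THEN conjunct2]
  note t = tD(3,4)[of 0, folded One_nat_def] tD(3,4)[of 1, unfolded Suc_1]
    tS(3,4)[of 0, folded One_nat_def] tS(3,4)[of 1, unfolded Suc_1]
  note even = transfer_step[OF q q'(1) tD(1,2) t(1,2) t(3,4) tS(1) t(5) t(7)
      d_power_gf_Cons geom_gf_mult IH]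
  note odd = transfer_step[OF q q'(2) tD(2,1) t(2,1) t(4,3) tS(2) t(6) t(8)
      d_power_gf_Cons geom_gf_mult IH(2,1,4,3,6,5)]
  show ?case
    unfolding g using even odd by blast
qed

text \<open>Serves both identities: \<open>W0\<close>, \<open>W1\<close>, \<open>W2\<close> stand
  for the even or the odd words with none, one or two letters \<open>z c\<close>. Coefficients agree
  after evaluation, and \<open>eval_eqI\<close> lifts this to \<open>H1\<close>.\<close>

lemma identity_from_gf:
  assumes gf: "\<And>ts. Abs_fps (\<lambda>n. eval ts (d (W2 n))) =
      2 * Abs_fps (\<lambda>n. eval ts (d (W1 n))) * z_gf c ts
      + d_power_gf ts * Abs_fps (\<lambda>n. eval ts (W2 n))
      - 4 * Abs_fps (\<lambda>n. eval ts (d (W0 n))) * z_pair_gf ts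
      - Abs_fps (\<lambda>n. eval ts (d (W0 n))) * z_gf (2 * c) ts"
  shows "d (W2 n) =
       2 * (\<Sum>(j, k)\<in>{(j, k). j + k = n}. d (W1 j) \<star> z ((a + b) * k + c))
       + (\<Sum>(j, k)\<in>{(j, k). j + k = n}. W2 j \<star> d (z (a + b) ^ k))
       - 4 * (\<Sum>(i, j, k)\<in>{(i, j, k). i + j + k = n}.
              d (W0 i) \<star> (z ((a + b) * j + c) * z ((a + b) * k + c)))
       - (\<Sum>(j, k)\<in>{(j, k). j + k = n}. d (W0 j) \<star> z ((a + b) * k + 2 * c))"
    (is "_ = ?R")
proof (rule eval_eqI)
  show "d (W2 n) \<in> H1" by (rule H1_d)
  show "?R \<in> H1"
    by (auto intro!: H1_d H1_harmonic H1_diff H1_add H1_numeral_mult H1_sum)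
  fix ts
  have "fps_nth (Abs_fps (\<lambda>n. eval ts (d (W2 n)))) n =
      fps_nth (2 * (Abs_fps (\<lambda>n. eval ts (d (W1 n))) * z_gf c ts)
      + Abs_fps (\<lambda>n. eval ts (W2 n)) * d_power_gf ts
      - 4 * (Abs_fps (\<lambda>n. eval ts (d (W0 n))) * z_pair_gf ts)
      - Abs_fps (\<lambda>n. eval ts (d (W0 n))) * z_gf (2 * c) ts) n"
    unfolding gf by (simp only: mult_ac)
  then show "eval ts (d (W2 n)) = eval ts ?R"
    unfolding fps_add_nth fps_sub_nth fps_numeral_mult_nth
    by (simp only: fps_mult_nth fps_nth_Abs_fps z_gf_def z_pair_gf_def d_power_gf_def sum_distrib_left
        sum_pairs_nat sum_triples_nat eval_add eval_diff eval_numeral_mult eval_sum eval_harmonic)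
qed

end

theorem theorem2p1:
  fixes a b c n :: nat
  assumes "a > 0" and "b > 0" and "c > 0"
  shows
    "d ((z c)^2 \<diamondop> (z a * z b)^n) =
       2 * (\<Sum>(j, k)\<in>{(j, k). j + k = n}.
              d (z c \<diamondop> (z a * z b)^j) \<star> z ((a + b) * k + c))
       + (\<Sum>(j, k)\<in>{(j, k). j + k = n}.
              ((z c)^2 \<diamondop> (z a * z b)^j) \<star> d ((z (a + b))^k))
       - 4 * (\<Sum>(i, j, k)\<in>{(i, j, k). i + j + k = n}.
              d ((z a * z b)^i) \<star> (z ((a + b) * j + c) * z ((a + b) * k + c)))
       - (\<Sum>(j, k)\<in>{(j, k). j + k = n}.
              d ((z a * z b)^j) \<star> z ((a + b) * k + 2 * c))
     \<and>
     d ((z c)^2 \<diamondop> (z b * (z a * z b)^n)) =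
       2 * (\<Sum>(j, k)\<in>{(j, k). j + k = n}.
              d (z c \<diamondop> (z b * (z a * z b)^j)) \<star> z ((a + b) * k + c))
       + (\<Sum>(j, k)\<in>{(j, k). j + k = n}.
              ((z c)^2 \<diamondop> (z b * (z a * z b)^j)) \<star> d ((z (a + b))^k))
       - 4 * (\<Sum>(i, j, k)\<in>{(i, j, k). i + j + k = n}.
              d (z b * (z a * z b)^i) \<star> (z ((a + b) * j + c) * z ((a + b) * k + c)))
       - (\<Sum>(j, k)\<in>{(j, k). j + k = n}.
              d (z b * (z a * z b)^j) \<star> z ((a + b) * k + 2 * c))"
proof -
  have words: "even_word a b c 0 m = (z a * z b) ^ m"
    "odd_word a b c 0 m = z b * (z a * z b) ^ m"
    "even_word a b c 1 m = z c \<diamondop> (z a * z b) ^ m"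
    "odd_word a b c 1 m = z c \<diamondop> (z b * (z a * z b) ^ m)"
    "even_word a b c 2 m = (z c)^2 \<diamondop> (z a * z b) ^ m"
    "odd_word a b c 2 m = (z c)^2 \<diamondop> (z b * (z a * z b) ^ m)" for m
    using assms by (simp_all add: even_word_0 odd_word_0)
      (simp_all add: even_word_def odd_word_def)
  note gf = gf_identities[OF assms, unfolded even_gf_def[OF assms] odd_gf_def[OF assms]]
  show ?thesis
    using identity_from_gf[OF assms, of "even_word a b c 2" "even_word a b c 1" "even_word a b c 0" n]
      identity_from_gf[OF assms, of "odd_word a b c 2" "odd_word a b c 1" "odd_word a b c 0" n]
      gf
    unfolding words by blast
qed

end
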